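(* Let $W=\{w\in\mathbb{R}^L:\exists\lambda\in\mathbb{R}^{L'},\ Aw+G\lambda\le e\}$ with $A\in\mathbb{R}^{m\times L}$, $G\in\mathbb{R}^{m\times L'}$, $e\in\mathbb{R}^m$. Under assumptions (A1)–(A5), the following two programs have the same optimal value. Program 1: $$\inf_{v,\gamma}\ \gamma\quad\text{s.t.}\quad \gamma\ge v(0,x)\ \forall x\in X_0;\quad \mathcal{L}_fv(t,x,w)\le0\ \forall(t,x,w)\in[0,T]\times X\times W;\quad v(t,x)\ge p(x)\ \forall(t,x)\in[0,T]\times X,$$ over $\gamma\in\mathbb{R}$, $v\in C^1([0,T]\times X)$. Program 2: $$\inf_{v,\gamma,\zeta}\ \gamma\quad\text{s.t.}\quad \gamma\ge v(0,x)\ \forall x\in X_0;\quad \mathcal{L}_{f_0}v(t,x)+e^T\zeta(t,x)\le0\ \forall(t,x)\in[0,T]\times X;$$ $$-(A^T\zeta(t,x))_\ell+f_\ell(t,x)\cdot\nabla_xv(t,x)=0\ \ \forall(t,x)\in[0,T]\times X,\ \ell=1,\dots,L;\quad G^T\zeta(t,x)=0\ \forall(t,x)\in[0,T]\times X;\quad v(t,x)\ge p(x)\ \forall(t,x)\in[0,T]\times X,$$ over $\gamma\in\mathbb{R}$, $v\in C^1([0,T]\times X)$, and $\zeta=(\zeta_1,\dots,\zeta_m)$ with each $\zeta_j$ a continuous nonnegative function on $[0,T]\times X$.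
   Context: Setting and assumptions. (A1) $T>0$ is finite. (A2) $X\subset\mathbb{R}^n$ and $X_0\subset X$ are compact. (A3) $f(t,x,w)=f_0(t,x)+\sum_{\ell=1}^Lw_\ell f_\ell(t,x)$ with $f_0,\dots,f_L$ valued in $\mathbb{R}^n$ and Lipschitz on $[0,T]\times X$. (A4) The polytope $W$ is compact with nonempty interior. (A5) Non-return: if a trajectory $x(\cdot\mid x_0,w(\cdot))$ of $\dot x=f(t,x,w)$ started at $x_0\in X_0$ with $W$-valued input satisfies $x(t\mid x_0,w(\cdot))\in\partial X$ for some $t\in[0,T]$, then $x(t'\mid x_0,\hat w(\cdot))\notin X$ for all $t'\in(t,T]$ and all $W$-valued inputs $\hat w(\cdot)$ that agree with $w(\cdot)$ on $[0,t]$. The objective $p$ is lower semicontinuous and bounded on $X$. Notation: $\mathcal{L}_{f_0}v=\partial_tv+f_0\cdot\nabla_xv$; $\mathcal{L}_fv(t,x,w)=\mathcal{L}_{f_0}v(t,x)+\sum_{\ell=1}^Lw_\ell\,f_\ell(t,x)\cdot\nabla_xv(t,x)$. $C^1([0,T]\times X)$ denotes functions with continuous first derivatives. *)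

theory Defs
  imports "HOL-Analysis.Analysis"
begin

text \<open>
  Points of \<open>[0,T] \<times> X\<close> are pairs \<open>(t, x)\<close>. Vector fields and test functions are total functions
  on \<^typ>\<open>real \<times> (real ^ 'n)\<close>; all regularity is required only on the sets named explicitly. In
  particular, the values of the vector fields off \<open>X\<close> matter only for trajectories that have
  left \<open>X\<close>.
\<close>

definition polytope_set ::
    "real ^ 'l ^ 'm \<Rightarrow> real ^ 'k ^ 'm \<Rightarrow> real ^ 'm \<Rightarrow> (real ^ 'l) set" where
  "polytope_set A G e = {w. \<exists>lam. A *v w + G *v lam \<le> e}"

definition dynamics ::
    "(real \<times> (real ^ 'n) \<Rightarrow> real ^ 'n) \<Rightarrow> ('l::finite \<Rightarrow> real \<times> (real ^ 'n) \<Rightarrow> real ^ 'n)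
      \<Rightarrow> real \<Rightarrow> real ^ 'n \<Rightarrow> real ^ 'l \<Rightarrow> real ^ 'n" where
  "dynamics f0 f t x w = f0 (t, x) + (\<Sum>l\<in>UNIV. (w $ l) *\<^sub>R f l (t, x))"

definition admissible_input :: "real \<Rightarrow> (real ^ 'l) set \<Rightarrow> (real \<Rightarrow> real ^ 'l) \<Rightarrow> bool" where
  "admissible_input T W w \<longleftrightarrow>
     w \<in> borel_measurable (lebesgue_on {0..T}) \<and> (\<forall>s\<in>{0..T}. w s \<in> W)"

text \<open>
  Inputs are only measurable, so solutions are meant in the sense of Caratheodory, expressed by
  the integral equation. A trajectory may exist on a proper subinterval \<open>[0,b]\<close> only.
\<close>

definition trajectory_on ::
    "(real \<times> (real ^ 'n) \<Rightarrow> real ^ 'n) \<Rightarrow> ('l::finite \<Rightarrow> real \<times> (real ^ 'n) \<Rightarrow> real ^ 'n)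
      \<Rightarrow> real \<Rightarrow> real ^ 'n \<Rightarrow> (real \<Rightarrow> real ^ 'l) \<Rightarrow> (real \<Rightarrow> real ^ 'n) \<Rightarrow> bool" where
  "trajectory_on f0 f b x0 w x \<longleftrightarrow>
     (\<lambda>s. dynamics f0 f s (x s) (w s)) absolutely_integrable_on {0..b} \<and>
     (\<forall>t\<in>{0..b}. x t = x0 + integral {0..t} (\<lambda>s. dynamics f0 f s (x s) (w s)))"

definition non_return ::
    "real \<Rightarrow> (real ^ 'n) set \<Rightarrow> (real ^ 'n) set \<Rightarrow> (real ^ 'l) set
      \<Rightarrow> (real \<times> (real ^ 'n) \<Rightarrow> real ^ 'n) \<Rightarrow> ('l::finite \<Rightarrow> real \<times> (real ^ 'n) \<Rightarrow> real ^ 'n) \<Rightarrow> bool" where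
  "non_return T X X0 W f0 f \<longleftrightarrow>
     (\<forall>x0\<in>X0. \<forall>w x. \<forall>t\<in>{0..T}.
        admissible_input T W w \<and> trajectory_on f0 f t x0 w x \<and> x t \<in> frontier X \<longrightarrow>
        (\<forall>w' x'. \<forall>t'\<in>{t<..T}.
           admissible_input T W w' \<and> (\<forall>s\<in>{0..t}. w' s = w s) \<and> trajectory_on f0 f t' x0 w' x'
           \<longrightarrow> x' t' \<notin> X))"

definition lower_semicontinuous_on :: "'a::topological_space set \<Rightarrow> ('a \<Rightarrow> real) \<Rightarrow> bool" where
  "lower_semicontinuous_on S p \<longleftrightarrow> (\<forall>x\<in>S. \<forall>c<p x. \<forall>\<^sub>F y in at x within S. c < p y)"

text \<open>
  On a set that need not be open, \<open>C\<^sup>1\<close> means continuously differentiable on some open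
  neighbourhood, so that the derivatives below are ordinary two-sided ones, also at boundary points.
\<close>

definition C1_on :: "'a::real_normed_vector set \<Rightarrow> ('a \<Rightarrow> real) \<Rightarrow> bool" where
  "C1_on S v \<longleftrightarrow>
     (\<exists>U v'. open U \<and> S \<subseteq> U \<and> (\<forall>z\<in>U. (v has_derivative blinfun_apply (v' z)) (at z)) \<and>
             continuous_on U v')"

definition time_deriv :: "(real \<times> (real ^ 'n) \<Rightarrow> real) \<Rightarrow> real \<Rightarrow> real ^ 'n \<Rightarrow> real" where
  "time_deriv v t x = deriv (\<lambda>s. v (s, x)) t"

definition space_grad :: "(real \<times> (real ^ 'n) \<Rightarrow> real) \<Rightarrow> real \<Rightarrow> real ^ 'n \<Rightarrow> real ^ 'n" where
  "space_grad v t x = (THE g. GDERIV (\<lambda>y. v (t, y)) x :> g)"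

definition Lie0 ::
    "(real \<times> (real ^ 'n) \<Rightarrow> real ^ 'n) \<Rightarrow> (real \<times> (real ^ 'n) \<Rightarrow> real)
      \<Rightarrow> real \<Rightarrow> real ^ 'n \<Rightarrow> real" where
  "Lie0 f0 v t x = time_deriv v t x + f0 (t, x) \<bullet> space_grad v t x"

definition Lie ::
    "(real \<times> (real ^ 'n) \<Rightarrow> real ^ 'n) \<Rightarrow> ('l::finite \<Rightarrow> real \<times> (real ^ 'n) \<Rightarrow> real ^ 'n)
      \<Rightarrow> (real \<times> (real ^ 'n) \<Rightarrow> real) \<Rightarrow> real \<Rightarrow> real ^ 'n \<Rightarrow> real ^ 'l \<Rightarrow> real" where
  "Lie f0 f v t x w = Lie0 f0 v t x + (\<Sum>l\<in>UNIV. w $ l * (f l (t, x) \<bullet> space_grad v t x))"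

definition feasible1 ::
    "real \<Rightarrow> (real ^ 'n) set \<Rightarrow> (real ^ 'n) set \<Rightarrow> (real ^ 'l) set
      \<Rightarrow> (real \<times> (real ^ 'n) \<Rightarrow> real ^ 'n) \<Rightarrow> ('l::finite \<Rightarrow> real \<times> (real ^ 'n) \<Rightarrow> real ^ 'n)
      \<Rightarrow> (real ^ 'n \<Rightarrow> real) \<Rightarrow> (real \<times> (real ^ 'n) \<Rightarrow> real) \<Rightarrow> real \<Rightarrow> bool" where
  "feasible1 T X X0 W f0 f p v \<gamma> \<longleftrightarrow>
     C1_on ({0..T} \<times> X) v \<and>
     (\<forall>x\<in>X0. \<gamma> \<ge> v (0, x)) \<and>
     (\<forall>t\<in>{0..T}. \<forall>x\<in>X. \<forall>w\<in>W. Lie f0 f v t x w \<le> 0) \<and>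
     (\<forall>t\<in>{0..T}. \<forall>x\<in>X. v (t, x) \<ge> p x)"

definition feasible2 ::
    "real \<Rightarrow> (real ^ 'n) set \<Rightarrow> (real ^ 'n) set
      \<Rightarrow> real ^ 'l ^ 'm \<Rightarrow> real ^ 'k ^ 'm \<Rightarrow> real ^ 'm
      \<Rightarrow> (real \<times> (real ^ 'n) \<Rightarrow> real ^ 'n) \<Rightarrow> ('l::finite \<Rightarrow> real \<times> (real ^ 'n) \<Rightarrow> real ^ 'n)
      \<Rightarrow> (real ^ 'n \<Rightarrow> real) \<Rightarrow> (real \<times> (real ^ 'n) \<Rightarrow> real) \<Rightarrow> real
      \<Rightarrow> (real \<times> (real ^ 'n) \<Rightarrow> real ^ 'm) \<Rightarrow> bool" where
  "feasible2 T X X0 A G e f0 f p v \<gamma> \<zeta> \<longleftrightarrow>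
     C1_on ({0..T} \<times> X) v \<and>
     (\<forall>j. continuous_on ({0..T} \<times> X) (\<lambda>z. \<zeta> z $ j) \<and> (\<forall>z\<in>{0..T} \<times> X. 0 \<le> \<zeta> z $ j)) \<and>
     (\<forall>x\<in>X0. \<gamma> \<ge> v (0, x)) \<and>
     (\<forall>t\<in>{0..T}. \<forall>x\<in>X. Lie0 f0 v t x + e \<bullet> \<zeta> (t, x) \<le> 0) \<and>
     (\<forall>t\<in>{0..T}. \<forall>x\<in>X. \<forall>l. - ((transpose A *v \<zeta> (t, x)) $ l) + f l (t, x) \<bullet> space_grad v t x = 0) \<and>
     (\<forall>t\<in>{0..T}. \<forall>x\<in>X. transpose G *v \<zeta> (t, x) = 0) \<and>
     (\<forall>t\<in>{0..T}. \<forall>x\<in>X. v (t, x) \<ge> p x)"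

text \<open>
  Optimal values are extended reals, so that an unbounded or infeasible program also has one.
\<close>

definition value1 ::
    "real \<Rightarrow> (real ^ 'n) set \<Rightarrow> (real ^ 'n) set \<Rightarrow> (real ^ 'l) set
      \<Rightarrow> (real \<times> (real ^ 'n) \<Rightarrow> real ^ 'n) \<Rightarrow> ('l::finite \<Rightarrow> real \<times> (real ^ 'n) \<Rightarrow> real ^ 'n)
      \<Rightarrow> (real ^ 'n \<Rightarrow> real) \<Rightarrow> ereal" where
  "value1 T X X0 W f0 f p = Inf {ereal \<gamma> | v \<gamma>. feasible1 T X X0 W f0 f p v \<gamma>}"

definition value2 ::
    "real \<Rightarrow> (real ^ 'n) set \<Rightarrow> (real ^ 'n) set
      \<Rightarrow> real ^ 'l ^ 'm \<Rightarrow> real ^ 'k ^ 'm \<Rightarrow> real ^ 'm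
      \<Rightarrow> (real \<times> (real ^ 'n) \<Rightarrow> real ^ 'n) \<Rightarrow> ('l::finite \<Rightarrow> real \<times> (real ^ 'n) \<Rightarrow> real ^ 'n)
      \<Rightarrow> (real ^ 'n \<Rightarrow> real) \<Rightarrow> ereal" where
  "value2 T X X0 A G e f0 f p = Inf {ereal \<gamma> | v \<gamma> \<zeta>. feasible2 T X X0 A G e f0 f p v \<gamma> \<zeta>}"

end

theory Submission
  imports Defs
begin

text \<open>
  For each \<open>(t, x)\<close> the existence of a multiplier is LP duality for the maximisation of
  \<open>w \<bullet> c\<close> over \<open>W\<close>, where \<open>c\<close> has the components \<open>f\<^sub>l \<bullet> \<nabla>\<^sub>x v\<close>. Replacing \<open>v\<close> by
  \<open>v + \<epsilon> (T - t)\<close> makes the Lie inequality strict at the cost \<open>\<epsilon> T\<close> in \<open>\<gamma>\<close>, and this slack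
  allows multipliers that depend continuously on \<open>c\<close>: optimal multipliers on a finite net are
  blended by a partition of unity, and the resulting small error in the equality constraints is
  repaired by a continuous, positive right inverse of \<open>\<zeta> \<mapsto> A\<^sup>T \<zeta>\<close>. This right inverse exists
  because \<open>W\<close> is nonempty and bounded.
\<close>

section \<open>Linear programming duality\<close>

text \<open>\<open>convex_cone hull Basis\<close> plays the nonnegative orthant: being finitely
  generated, it has closed linear images, and this lemma turns membership back into signs of
  coordinates.\<close>

lemma convex_cone_hull_Basis_nonneg:
  fixes z :: "'a::euclidean_space"
  assumes "z \<in> convex_cone hull Basis" "i \<in> Basis"
  shows "0 \<le> z \<bullet> i"
proof -
  have "convex_cone hull Basis \<subseteq> {z::'a. \<forall>i\<in>Basis. 0 \<le> z \<bullet> i}"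
  proof (rule hull_minimal)
    show "Basis \<subseteq> {z::'a. \<forall>i\<in>Basis. 0 \<le> z \<bullet> i}"
      by (auto simp: inner_Basis)
    show "convex_cone {z::'a. \<forall>i\<in>Basis. 0 \<le> z \<bullet> i}"
      by (auto simp: convex_cone_iff inner_add_left)
  qed
  then show ?thesis using assms by blast
qed

text \<open>Strict separation gives a level \<open>b\<close>, negative because the cone contains 0.
  Invariance under scaling then lifts the lower bound on the cone from \<open>b\<close> to
  0.\<close>

lemma convex_cone_separation:
  fixes S :: "'a::euclidean_space set"
  assumes "convex_cone S" "closed S" "z \<notin> S"
  obtains a where "a \<bullet> z < 0" "\<And>x. x \<in> S \<Longrightarrow> 0 \<le> a \<bullet> x"
proof -
  obtain a b where ab: "a \<bullet> z < b" "\<And>x. x \<in> S \<Longrightarrow> b < a \<bullet> x"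
    using separating_hyperplane_closed_point[of S z] assms by (auto simp: convex_cone_def)
  have "0 \<in> S" using assms(1) convex_cone_contains_0 by blast
  with ab(2)[of 0] have b: "b < 0" by simp
  have "0 \<le> a \<bullet> x" if x: "x \<in> S" for x
  proof (rule ccontr)
    assume neg: "\<not> 0 \<le> a \<bullet> x"
    \<comment> \<open>This multiple of \<open>x\<close> lies exactly on the level \<open>b\<close>,
      which strict separation excludes.\<close>
    have "(b / (a \<bullet> x)) *\<^sub>R x \<in> S"
      using assms(1) x b neg by (auto intro!: convex_cone_scaleR divide_nonpos_nonpos)
    from ab(2)[OF this] show False using neg by simp
  qed
  moreover have "a \<bullet> z < 0" using ab b by linarith
  ultimately show ?thesis using that by blast
qed

text \<open>A Farkas argument. The wanted multiplier exists iff \<open>(c, 0, h)\<close> lies in a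
  finitely generated, hence closed, cone. Otherwise a separating functional yields either a point of
  the polytope violating the bound or a direction along which the objective is unbounded.\<close>

lemma polytope_set_dual:
  fixes A :: "real ^ 'l ^ 'm" and G :: "real ^ 'k ^ 'm" and e :: "real ^ 'm" and c :: "real ^ 'l"
  assumes ne: "polytope_set A G e \<noteq> {}"
    and le: "\<And>w. w \<in> polytope_set A G e \<Longrightarrow> w \<bullet> c \<le> h"
  obtains \<zeta> where "0 \<le> \<zeta>" "\<zeta> v* A = c" "\<zeta> v* G = 0" "e \<bullet> \<zeta> \<le> h"
proof -
  \<comment> \<open>The real coordinate \<open>s\<close> is a slack variable: it turns
    \<open>e \<bullet> \<zeta> \<le> h\<close> into an equation with
    \<open>0 \<le> s\<close>.\<close>
  define F :: "(real ^ 'm) \<times> real \<Rightarrow> (real ^ 'l) \<times> (real ^ 'k) \<times> real"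
    where "F = (\<lambda>(\<zeta>, s). (\<zeta> v* A, \<zeta> v* G, e \<bullet> \<zeta> + s))"
  have lin: "linear F"
    unfolding F_def
    by (auto intro!: linearI simp: vector_matrix_left_distrib scaleR_vector_matrix_assoc
        inner_add_right algebra_simps)
  define S where "S = convex_cone hull (F ` Basis)"
  have S: "S = F ` (convex_cone hull Basis)"
    unfolding S_def by (rule convex_cone_hull_linear_image[OF lin])
  have "(c, 0, h) \<in> S"
  proof (rule ccontr)
    assume "(c, 0, h) \<notin> S"
    moreover have "closed S" unfolding S_def by (intro closed_convex_cone_hull) simp
    ultimately obtain a where a: "a \<bullet> (c, 0, h) < 0" "\<And>x. x \<in> S \<Longrightarrow> 0 \<le> a \<bullet> x"
      using convex_cone_separation[of S "(c, 0, h)"]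
        convex_cone_convex_cone_hull[of "F ` Basis"] unfolding S_def by blast
    obtain u \<mu> \<tau> where a_eq: "a = (u, \<mu>, \<tau>)" by (cases a) auto
    have gen: "0 \<le> a \<bullet> F b" if "b \<in> Basis" for b
      using a(2)[of "F b"] that unfolding S_def by (auto intro: hull_inc)
    \<comment> \<open>The functional is tested on the generators of the cone: the axis vectors give
      this inequality, the slack generator gives the sign of \<open>\<tau>\<close>.\<close>
    have ineq: "0 \<le> (A *v u + G *v \<mu> + \<tau> *\<^sub>R e) $ j" for j
    proof -
      have "0 \<le> a \<bullet> F (axis j 1, 0)"
        by (rule gen) (auto simp: Basis_prod_def axis_in_Basis_iff)
      also have "\<dots> = (axis j 1) \<bullet> (A *v u) + (axis j 1) \<bullet> (G *v \<mu>) + \<tau> * (axis j 1 \<bullet> e)"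
        by (simp add: a_eq F_def dot_lmul_matrix[symmetric] inner_commute)
      finally show ?thesis by (simp add: inner_axis')
    qed
    have "0 \<le> a \<bullet> F (0, 1)" by (rule gen) (auto simp: Basis_prod_def)
    then have \<tau>: "0 \<le> \<tau>" by (simp add: a_eq F_def)
    have neg: "u \<bullet> c + \<tau> * h < 0" using a(1) by (simp add: a_eq)
    show False
    proof (cases "\<tau> = 0")
      case False
      \<comment> \<open>For positive \<open>\<tau>\<close>, dividing \<open>ineq\<close> by it shows
        that \<open>- u / \<tau>\<close> is in the polytope, with auxiliary vector
        \<open>- \<mu> / \<tau>\<close>; by \<open>neg\<close> its objective exceeds
        \<open>h\<close>.\<close>
      define r where "r = - (1 / \<tau>)"
      have "r *\<^sub>R u \<in> polytope_set A G e"
        unfolding polytope_set_def mem_Collect_eq less_eq_vec_def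
      proof (intro exI[of _ "r *\<^sub>R \<mu>"] allI)
        fix j
        show "(A *v (r *\<^sub>R u) + G *v (r *\<^sub>R \<mu>)) $ j \<le> e $ j"
          using ineq[of j] \<tau> False
          unfolding matrix_vector_mult_scaleR by (simp add: r_def field_simps)
      qed
      from le[OF this] have "- (u \<bullet> c) / \<tau> \<le> h" by (simp add: r_def)
      then show False using neg \<tau> False by (simp add: field_simps)
    next
      case True
      \<comment> \<open>For \<open>\<tau> = 0\<close>, the vector \<open>- u\<close> is a recession
        direction of the polytope, and the objective grows along it since
        \<open>u \<bullet> c < 0\<close>.\<close>
      obtain w0 lam where w0: "\<And>j. (A *v w0 + G *v lam) $ j \<le> e $ j"
        using ne by (auto simp: polytope_set_def less_eq_vec_def)
      have "w0 - r *\<^sub>R u \<in> polytope_set A G e" if "0 \<le> r" for r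
        unfolding polytope_set_def mem_Collect_eq less_eq_vec_def
      proof (intro exI[of _ "lam - r *\<^sub>R \<mu>"] allI)
        fix j
        have "0 \<le> r * ((A *v u + G *v \<mu>) $ j)"
          using ineq[of j] True that by simp
        then show "(A *v (w0 - r *\<^sub>R u) + G *v (lam - r *\<^sub>R \<mu>)) $ j \<le> e $ j"
          using w0[of j]
          by (simp add: matrix_vector_mult_scaleR matrix_vector_mult_diff_distrib algebra_simps)
      qed
      then have *: "w0 \<bullet> c - r * (u \<bullet> c) \<le> h" if "0 \<le> r" for r
        using le[of "w0 - r *\<^sub>R u"] that by (simp add: inner_diff_left)
      have uc: "u \<bullet> c < 0" using neg True by simp
      \<comment> \<open>This makes the step length used next nonnegative; at that length the
        objective equals \<open>h + 1\<close>.\<close>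
      have "w0 \<bullet> c \<le> h" using *[of 0] by simp
      then show False
        using *[of "(h - w0 \<bullet> c + 1) / (- (u \<bullet> c))"] uc by (simp add: divide_simps split: if_splits)
    qed
  qed
  then obtain \<zeta> s where in_hull: "(\<zeta>, s) \<in> convex_cone hull Basis" and eq: "(c, 0, h) = F (\<zeta>, s)"
    unfolding S by auto
  have "0 \<le> \<zeta> $ j" for j
    using convex_cone_hull_Basis_nonneg[OF in_hull, of "(axis j 1, 0)"]
    by (auto simp: Basis_prod_def axis_in_Basis_iff inner_axis)
  moreover have "0 \<le> s"
    using convex_cone_hull_Basis_nonneg[OF in_hull, of "(0, 1)"] by (auto simp: Basis_prod_def)
  ultimately show ?thesis
    using eq that[of \<zeta>] by (auto simp: F_def less_eq_vec_def)
qed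

section \<open>Continuous selection of multipliers\<close>

lemma linear_vector_matrix_mult: "linear (\<lambda>x :: real ^ 'm. x v* (M :: real ^ 'n ^ 'm))"
  using matrix_vector_mul_linear[of "transpose M"] by simp

text \<open>Boundedness makes every linear objective bounded above, so duality represents every
  \<open>c\<close>. Representing only the signed axis vectors and combining them with the positive
  and negative parts of the coordinates of \<open>c\<close> gives continuity and linear growth of
  the cost.\<close>

lemma polytope_set_positive_right_inverse:
  fixes A :: "real ^ 'l ^ 'm" and G :: "real ^ 'k ^ 'm" and e :: "real ^ 'm"
  assumes "polytope_set A G e \<noteq> {}" "bounded (polytope_set A G e)"
  obtains R K where "continuous_on UNIV R" "\<And>c. 0 \<le> R c" "\<And>c. R c v* A = c" "\<And>c. R c v* G = 0"
    "0 \<le> K" "\<And>c. e \<bullet> R c \<le> K * norm c"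
proof -
  obtain B where B: "\<And>w. w \<in> polytope_set A G e \<Longrightarrow> norm w \<le> B"
    using assms(2) by (auto simp: bounded_iff)
  have "\<exists>\<zeta>. 0 \<le> \<zeta> \<and> \<zeta> v* A = c \<and> \<zeta> v* G = 0" for c
  proof -
    have "w \<bullet> c \<le> B * norm c" if "w \<in> polytope_set A G e" for w
      using norm_cauchy_schwarz[of w c] mult_right_mono[OF B[OF that], of "norm c"] by simp
    then show ?thesis using polytope_set_dual[OF assms(1)] by metis
  qed
  \<comment> \<open>\<open>N\<close> need not be continuous: only its finitely many values at signed
    axis vectors enter \<open>R\<close>.\<close>
  then obtain N where N: "\<And>c. 0 \<le> N c" "\<And>c. N c v* A = c" "\<And>c. N c v* G = 0" by metis
  define R where "R = (\<lambda>c :: real ^ 'l. \<Sum>l\<in>UNIV.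
    max 0 (c $ l) *\<^sub>R N (axis l 1) + max 0 (- c $ l) *\<^sub>R N (- axis l 1))"
  define K where "K = (\<Sum>l\<in>UNIV. \<bar>e \<bullet> N (axis l 1)\<bar> + \<bar>e \<bullet> N (- axis l 1)\<bar>)"
  note R_linear = linear_sum[OF linear_vector_matrix_mult] linear_add[OF linear_vector_matrix_mult]
    linear_cmul[OF linear_vector_matrix_mult]
  show ?thesis
  proof (rule that)
    show "continuous_on UNIV R" unfolding R_def by (intro continuous_intros)
    show "0 \<le> R c" for c
      using N(1) unfolding R_def less_eq_vec_def by (auto intro!: sum_nonneg)
    show "R c v* A = c" for c
    proof -
      have "R c v* A = (\<Sum>l\<in>UNIV. (max 0 (c $ l) - max 0 (- c $ l)) *\<^sub>R axis l 1)"
        unfolding R_def by (simp add: R_linear N algebra_simps)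
      also have "\<dots> = (\<Sum>l\<in>UNIV. c $ l *\<^sub>R axis l 1)"
        by (intro sum.cong refl arg_cong2[where f = scaleR]) auto
      also have "\<dots> = c" using basis_expansion[of c] by (simp add: scalar_mult_eq_scaleR)
      finally show ?thesis .
    qed
    show "R c v* G = 0" for c unfolding R_def by (simp add: R_linear N)
    show "0 \<le> K" unfolding K_def by (auto intro: sum_nonneg)
    show "e \<bullet> R c \<le> K * norm c" for c
    proof -
      have le: "max 0 y * a \<le> \<bar>a\<bar> * norm c" if "\<bar>y\<bar> \<le> norm c" for y a :: real
        using that mult_mono[of "max 0 y" "norm c" a "\<bar>a\<bar>"]
        by (smt (verit) abs_ge_zero mult.commute mult_left_mono mult_mono norm_ge_zero abs_ge_self)
      have "e \<bullet> R c = (\<Sum>l\<in>UNIV. max 0 (c $ l) * (e \<bullet> N (axis l 1))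
          + max 0 (- c $ l) * (e \<bullet> N (- axis l 1)))"
        unfolding R_def by (simp add: inner_sum_right inner_add_right)
      also have "\<dots> \<le> (\<Sum>l\<in>UNIV. \<bar>e \<bullet> N (axis l 1)\<bar> * norm c + \<bar>e \<bullet> N (- axis l 1)\<bar> * norm c)"
        by (intro sum_mono add_mono le) (use component_le_norm_cart[of c] in auto)
      finally show ?thesis unfolding K_def by (simp add: sum_distrib_right distrib_right)
    qed
  qed
qed

text \<open>Tent functions of radius \<open>\<delta>\<close> around a finite net are divided by
  their sum, which is positive on \<open>D\<close> because the balls cover it.\<close>

lemma compact_partition_of_unity:
  fixes D :: "'a::metric_space set"
  assumes "compact D" "0 < \<delta>"
  obtains N \<phi> where "finite N" "\<And>i. continuous_on D (\<phi> i)" "\<And>i c. 0 \<le> \<phi> i c"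
    "\<And>c. c \<in> D \<Longrightarrow> (\<Sum>i\<in>N. \<phi> i c) = (1::real)" "\<And>i c. \<phi> i c \<noteq> 0 \<Longrightarrow> dist c i \<le> \<delta>"
proof -
  obtain N where N: "finite N" "D \<subseteq> (\<Union>x\<in>N. ball x \<delta>)"
    using seq_compact_imp_totally_bounded[OF compact_imp_seq_compact[OF assms(1)], rule_format, OF assms(2)]
    by blast
  define \<psi> where "\<psi> = (\<lambda>i c :: 'a. max 0 (\<delta> - dist c i))"
  have pos: "0 < (\<Sum>i\<in>N. \<psi> i c)" if c: "c \<in> D" for c
  proof -
    obtain i where "i \<in> N" "dist c i < \<delta>" using N(2) c by (auto simp: dist_commute)
    then show ?thesis by (intro sum_pos2[OF N(1), of i]) (auto simp: \<psi>_def)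
  qed
  have cont: "continuous_on D (\<psi> i)" for i
    unfolding \<psi>_def by (intro continuous_intros)
  show ?thesis
  proof (rule that[OF N(1), of "\<lambda>i c. \<psi> i c / (\<Sum>i\<in>N. \<psi> i c)"])
    show "continuous_on D (\<lambda>c. \<psi> i c / (\<Sum>i\<in>N. \<psi> i c))" for i
      by (intro continuous_on_divide continuous_on_sum cont ballI) (metis pos less_irrefl)
    \<comment> \<open>Off \<open>D\<close> the denominator may vanish; the quotient is then 0, so
      this and the support condition hold at every point.\<close>
    show "0 \<le> \<psi> i c / (\<Sum>i\<in>N. \<psi> i c)" for i c
      by (auto simp: \<psi>_def intro!: divide_nonneg_nonneg sum_nonneg)
    show "(\<Sum>i\<in>N. \<psi> i c / (\<Sum>i\<in>N. \<psi> i c)) = 1" if "c \<in> D" for c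
      using pos[OF that] by (simp add: sum_divide_distrib[symmetric])
    show "dist c i \<le> \<delta>" if "\<psi> i c / (\<Sum>i\<in>N. \<psi> i c) \<noteq> 0" for i c
      using that by (auto simp: \<psi>_def max_def split: if_splits)
  qed
qed

lemma polytope_set_continuous_dual_selection:
  fixes A :: "real ^ 'l ^ 'm" and G :: "real ^ 'k ^ 'm" and e :: "real ^ 'm"
    and D :: "(real ^ 'l) set"
  assumes W: "W = polytope_set A G e" "W \<noteq> {}" "compact W" and D: "compact D" and "0 < \<epsilon>"
  obtains S where "continuous_on D S" "\<And>c. c \<in> D \<Longrightarrow> 0 \<le> S c" "\<And>c. c \<in> D \<Longrightarrow> S c v* A = c"
    "\<And>c. c \<in> D \<Longrightarrow> S c v* G = 0" "\<And>c. c \<in> D \<Longrightarrow> \<exists>w\<in>W. e \<bullet> S c \<le> w \<bullet> c + \<epsilon>"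
proof -
  obtain R K where R: "continuous_on UNIV R" "\<And>c. 0 \<le> R c" "\<And>c. R c v* A = c" "\<And>c. R c v* G = 0"
    "0 \<le> K" "\<And>c. e \<bullet> R c \<le> K * norm c"
    using polytope_set_positive_right_inverse[of A G e] W compact_imp_bounded by metis
  obtain B where B: "0 < B" "\<And>w. w \<in> W \<Longrightarrow> norm w \<le> B"
    using compact_imp_bounded[OF W(3)] by (auto simp: bounded_pos)
  \<comment> \<open>Two errors must add up to \<open>\<epsilon>\<close>: \<open>B * \<delta>\<close>
    from using a multiplier chosen for a nearby objective, and \<open>K * \<delta>\<close> from
    repairing the equality constraint.\<close>
  define \<delta> where "\<delta> = \<epsilon> / (B + K)"
  have "0 < B + K" using B(1) R(5) by simp
  then have \<delta>: "0 < \<delta>" "B * \<delta> + K * \<delta> = \<epsilon>"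
    using \<open>0 < \<epsilon>\<close> unfolding distrib_right[symmetric] by (simp_all add: \<delta>_def)
  have "\<exists>w\<in>W. \<forall>w'\<in>W. w' \<bullet> c \<le> w \<bullet> c" for c
    by (intro continuous_attains_sup W continuous_intros)
  then obtain w where w: "\<And>c. w c \<in> W" "\<And>c w'. w' \<in> W \<Longrightarrow> w' \<bullet> c \<le> w c \<bullet> c" by metis
  have "\<exists>\<zeta>. 0 \<le> \<zeta> \<and> \<zeta> v* A = c \<and> \<zeta> v* G = 0 \<and> e \<bullet> \<zeta> \<le> w c \<bullet> c" for c
    by (rule polytope_set_dual[of A G e c "w c \<bullet> c"]) (use W w(2) in auto)
  then obtain Z where Z: "\<And>c. 0 \<le> Z c" "\<And>c. Z c v* A = c" "\<And>c. Z c v* G = 0"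
      "\<And>c. e \<bullet> Z c \<le> w c \<bullet> c"
    by metis
  show ?thesis
  proof (rule compact_partition_of_unity[OF D \<delta>(1)])
    fix N \<phi>
    assume "finite N" and \<phi>: "\<And>i. continuous_on D (\<phi> i)" "\<And>i c. 0 \<le> \<phi> i c"
      "\<And>c. c \<in> D \<Longrightarrow> (\<Sum>i\<in>N. \<phi> i c) = (1::real)" "\<And>i c. \<phi> i c \<noteq> 0 \<Longrightarrow> dist c i \<le> \<delta>"
    \<comment> \<open>The blended multiplier is mapped by \<open>A\<close> to the blend of the net
      points; \<open>r c\<close> is what is missing to reach \<open>c\<close>, and \<open>R\<close>
      supplies it without losing nonnegativity.\<close>
    define r where "r = (\<lambda>c. c - (\<Sum>i\<in>N. \<phi> i c *\<^sub>R i))"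
    define S where "S = (\<lambda>c. (\<Sum>i\<in>N. \<phi> i c *\<^sub>R Z i) + R (r c))"
    note S_linear = linear_sum[OF linear_vector_matrix_mult] linear_add[OF linear_vector_matrix_mult]
      linear_cmul[OF linear_vector_matrix_mult]
    show ?thesis
    proof (rule that)
      have "continuous_on D r" unfolding r_def by (intro continuous_intros \<phi>)
      then have "continuous_on D (\<lambda>c. R (r c))"
        using continuous_on_compose2[OF R(1)] by blast
      then show "continuous_on D S" unfolding S_def by (intro continuous_intros \<phi>)
      fix c assume c: "c \<in> D"
      show "0 \<le> S c"
        using Z(1) R(2) \<phi>(2) unfolding S_def less_eq_vec_def by (auto intro!: sum_nonneg add_nonneg_nonneg)
      show "S c v* A = c" unfolding S_def by (simp add: S_linear Z R r_def)
      show "S c v* G = 0" unfolding S_def by (simp add: S_linear Z R)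
      \<comment> \<open>As the weights sum to 1, \<open>r c\<close> is a convex combination of
        differences \<open>c - i\<close>, and those with nonzero weight have norm at most
        \<open>\<delta>\<close>.\<close>
      have "norm (r c) = norm (\<Sum>i\<in>N. \<phi> i c *\<^sub>R (c - i))"
        using \<phi>(3)[OF c]
        by (simp add: r_def scaleR_diff_right sum_subtractf scaleR_left.sum[symmetric])
      also have "\<dots> \<le> (\<Sum>i\<in>N. \<phi> i c * \<delta>)"
      proof (rule sum_norm_le)
        fix i
        show "norm (\<phi> i c *\<^sub>R (c - i)) \<le> \<phi> i c * \<delta>"
          using \<phi>(2)[of i c] \<phi>(4)[of i c]
          by (cases "\<phi> i c = 0") (auto simp: dist_norm intro: mult_left_mono)
      qed
      also have "\<dots> = \<delta>" using \<phi>(3)[OF c] by (simp add: sum_distrib_right[symmetric])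
      finally have "norm (r c) \<le> \<delta>" .
      then have Rr: "e \<bullet> R (r c) \<le> K * \<delta>"
        using R(6)[of "r c"] mult_left_mono[OF _ R(5)] by (meson order_trans)
      have "e \<bullet> (\<Sum>i\<in>N. \<phi> i c *\<^sub>R Z i) = (\<Sum>i\<in>N. \<phi> i c * (e \<bullet> Z i))"
        by (simp add: inner_sum_right)
      also have "\<dots> \<le> (\<Sum>i\<in>N. \<phi> i c * (w c \<bullet> c + B * \<delta>))"
      proof (rule sum_mono)
        fix i
        show "\<phi> i c * (e \<bullet> Z i) \<le> \<phi> i c * (w c \<bullet> c + B * \<delta>)"
        proof (cases "\<phi> i c = 0")
          case False
          \<comment> \<open>The maximiser \<open>w i\<close> for objective \<open>i\<close> is also
            a competitor for objective \<open>c\<close>, so the optimal value rises by at most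
            \<open>B * \<delta>\<close> from \<open>c\<close> to \<open>i\<close>.\<close>
          have "w i \<bullet> (i - c) \<le> norm (w i) * norm (i - c)" by (rule norm_cauchy_schwarz)
          also have "\<dots> \<le> B * \<delta>"
            using B w(1) \<phi>(4)[OF False] by (intro mult_mono) (auto simp: dist_norm norm_minus_commute)
          finally have "w i \<bullet> i \<le> w i \<bullet> c + B * \<delta>" by (simp add: inner_diff_right)
          then have "e \<bullet> Z i \<le> w c \<bullet> c + B * \<delta>"
            using Z(4)[of i] w(2)[OF w(1)[of i], of c] by linarith
          then show ?thesis using \<phi>(2) by (rule mult_left_mono)
        qed simp
      qed
      also have "\<dots> = w c \<bullet> c + B * \<delta>" using \<phi>(3)[OF c] by (simp add: sum_distrib_right[symmetric])
      finally have "e \<bullet> S c \<le> w c \<bullet> c + \<epsilon>"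
        using Rr \<delta>(2) by (simp add: S_def inner_add_right)
      then show "\<exists>w\<in>W. e \<bullet> S c \<le> w \<bullet> c + \<epsilon>" using w(1) by blast
    qed
  qed
qed

section \<open>Equality of the optimal values\<close>

lemma has_derivative_time_deriv:
  assumes "(v has_derivative D) (at (t, x))"
  shows "time_deriv v t x = D (1, 0)"
proof -
  have "((\<lambda>s. v (s, x)) has_derivative (\<lambda>h. D (h, 0))) (at t)"
    by (rule has_derivative_compose[where f = "\<lambda>s. (s, x)" and f' = "\<lambda>h. (h, 0)"])
      (use assms in \<open>auto intro!: derivative_eq_intros\<close>)
  moreover have "(\<lambda>h. D (h, 0)) = (\<lambda>h. D (1, 0) * h)"
  proof
    fix h :: real
    show "D (h, 0) = D (1, 0) * h"
      using linear_cmul[OF has_derivative_linear[OF assms], of h "(1, 0)"] by simp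
  qed
  ultimately show ?thesis
    unfolding time_deriv_def by (intro DERIV_imp_deriv) (simp add: has_field_derivative_def)
qed

text \<open>The gradient is a definite description, so existence and uniqueness are both needed: the
  vector representing the spatial part of \<open>D\<close> is a gradient, and inner products
  determine it.\<close>

lemma has_derivative_space_grad:
  fixes x :: "real ^ 'n"
  assumes "(v has_derivative D) (at (t, x))"
  shows "space_grad v t x = (\<Sum>b\<in>Basis. D (0, b) *\<^sub>R b)"
proof -
  define g :: "real ^ 'n" where "g = (\<Sum>b\<in>Basis. D (0, b) *\<^sub>R b)"
  have lin: "linear (\<lambda>h. D (0, h))"
    using linear_compose[OF _ has_derivative_linear[OF assms], of "\<lambda>h. (0, h)"]
    by (simp add: o_def linear_iff)
  have "((\<lambda>y. v (t, y)) has_derivative (\<lambda>h. D (0, h))) (at x)"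
    by (rule has_derivative_compose[where f = "\<lambda>y. (t, y)" and f' = "\<lambda>h. (0, h)"])
      (use assms in \<open>auto intro!: derivative_eq_intros\<close>)
  moreover have "D (0, h) = h \<bullet> g" for h
  proof -
    have "D (0, h) = D (0, \<Sum>b\<in>Basis. (h \<bullet> b) *\<^sub>R b)" by (simp add: euclidean_representation)
    also have "\<dots> = (\<Sum>b\<in>Basis. (h \<bullet> b) * D (0, b))"
      by (simp add: linear_sum[OF lin] linear_cmul[OF lin])
    finally show ?thesis by (simp add: g_def inner_sum_right mult.commute)
  qed
  ultimately have g: "GDERIV (\<lambda>y. v (t, y)) x :> g" by (simp add: gderiv_def)
  have unique: "g' = g" if "GDERIV (\<lambda>y. v (t, y)) x :> g'" for g'
  proof -
    have "(\<lambda>h. h \<bullet> g') = (\<lambda>h. h \<bullet> g)"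
      using that g unfolding gderiv_def by (rule has_derivative_unique)
    then have "\<forall>h. h \<bullet> g' = h \<bullet> g" by (simp add: fun_eq_iff)
    then show ?thesis by (simp only: vector_eq_ldot)
  qed
  show ?thesis
    unfolding space_grad_def g_def[symmetric] using g unique by (rule the_equality)
qed

lemma continuous_on_space_grad:
  assumes "C1_on S v"
  shows "continuous_on S (\<lambda>z. space_grad v (fst z) (snd z))"
proof -
  obtain U v' where U: "S \<subseteq> U" "\<And>z. z \<in> U \<Longrightarrow> (v has_derivative blinfun_apply (v' z)) (at z)"
    "continuous_on U v'"
    using assms unfolding C1_on_def by blast
  have "continuous_on S (\<lambda>z. \<Sum>b\<in>Basis. blinfun_apply (v' z) (0, b) *\<^sub>R b)"
    by (intro continuous_intros continuous_on_subset[OF U(3,1)])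
  then show ?thesis
    by (rule continuous_on_eq) (use U has_derivative_space_grad in fastforce)
qed

lemma C1_on_add_linear_time:
  fixes v :: "real \<times> (real ^ 'n) \<Rightarrow> real"
  assumes "C1_on S v"
  shows "C1_on S (\<lambda>z. v z + \<epsilon> * (T - fst z))"
    and "(t, x) \<in> S \<Longrightarrow> space_grad (\<lambda>z. v z + \<epsilon> * (T - fst z)) t x = space_grad v t x"
    and "(t, x) \<in> S \<Longrightarrow> time_deriv (\<lambda>z. v z + \<epsilon> * (T - fst z)) t x = time_deriv v t x - \<epsilon>"
proof -
  obtain U v' where U: "open U" "S \<subseteq> U"
    "\<And>z. z \<in> U \<Longrightarrow> (v has_derivative blinfun_apply (v' z)) (at z)" "continuous_on U v'"
    using assms unfolding C1_on_def by blast
  \<comment> \<open>The added term depends on time alone with slope \<open>- \<epsilon>\<close>, so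
    it vanishes on the directions \<open>(0, b)\<close> that make up the gradient.\<close>
  define v1 where "v1 = (\<lambda>z. v' z - \<epsilon> *\<^sub>R fst_blinfun)"
  have der: "((\<lambda>z. v z + \<epsilon> * (T - fst z)) has_derivative blinfun_apply (v1 z)) (at z)"
    if "z \<in> U" for z
    using U(3)[OF that]
    by (auto intro!: derivative_eq_intros simp: v1_def blinfun.diff_left blinfun.scaleR_left)
  moreover have "continuous_on U v1" unfolding v1_def by (intro continuous_intros U)
  ultimately show "C1_on S (\<lambda>z. v z + \<epsilon> * (T - fst z))"
    using U(1,2) unfolding C1_on_def by blast
  assume "(t, x) \<in> S"
  then have "(t, x) \<in> U" using U(2) by blast
  note der = der[OF this] U(3)[OF this]
  show "space_grad (\<lambda>z. v z + \<epsilon> * (T - fst z)) t x = space_grad v t x"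
    using der[THEN has_derivative_space_grad]
    by (simp add: v1_def blinfun.diff_left blinfun.scaleR_left)
  show "time_deriv (\<lambda>z. v z + \<epsilon> * (T - fst z)) t x = time_deriv v t x - \<epsilon>"
    using der[THEN has_derivative_time_deriv]
    by (simp add: v1_def blinfun.diff_left blinfun.scaleR_left)
qed

section \<open>Passing between feasible points of the two programs\<close>

lemma feasible2_imp_feasible1:
  assumes "feasible2 T X X0 A G e f0 f p v \<gamma> \<zeta>"
  shows "feasible1 T X X0 (polytope_set A G e) f0 f p v \<gamma>"
proof -
  have "Lie f0 f v t x w \<le> 0"
    if tx: "t \<in> {0..T}" "x \<in> X" and w: "w \<in> polytope_set A G e" for t x w
  proof -
    let ?z = "\<zeta> (t, x)"
    obtain lam where lam: "A *v w + G *v lam \<le> e" using w by (auto simp: polytope_set_def)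
    have f: "f l (t, x) \<bullet> space_grad v t x = (?z v* A) $ l" for l
      using assms tx by (auto simp: feasible2_def)
    have "(\<Sum>l\<in>UNIV. w $ l * (f l (t, x) \<bullet> space_grad v t x)) = (?z v* A) \<bullet> w"
      unfolding f by (simp add: inner_vec_def mult.commute)
    \<comment> \<open>Weak duality: the added term is zero, and it completes the left side of the
      inequality defining the polytope, which is then weighted by the nonnegative
      multiplier.\<close>
    also have "\<dots> = (?z v* A) \<bullet> w + (?z v* G) \<bullet> lam"
      using assms tx by (simp add: feasible2_def)
    also have "\<dots> = ?z \<bullet> (A *v w + G *v lam)" by (simp add: dot_lmul_matrix inner_add_right)
    also have "\<dots> \<le> ?z \<bullet> e"
      unfolding inner_vec_def using assms tx lam
      by (intro sum_mono) (auto simp: feasible2_def less_eq_vec_def intro!: mult_left_mono)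
    finally have "Lie f0 f v t x w \<le> Lie0 f0 v t x + e \<bullet> ?z"
      by (simp add: Lie_def inner_commute[of e])
    also have "\<dots> \<le> 0" using assms tx by (simp add: feasible2_def)
    finally show ?thesis .
  qed
  then show ?thesis using assms by (simp add: feasible1_def feasible2_def)
qed

text \<open>The multiplier is the continuous selection composed with the coefficient vector
  \<open>c\<close> of \<open>w\<close> in the Lie derivative. Tilting \<open>v\<close> in time keeps
  \<open>c\<close> unchanged and pays for the suboptimality of the selection.\<close>

lemma feasible1_imp_feasible2:
  fixes f :: "'l::finite \<Rightarrow> real \<times> (real ^ 'n) \<Rightarrow> real ^ 'n" and A :: "real ^ 'l ^ 'm"
  assumes feas: "feasible1 T X X0 W f0 f p v \<gamma>"
    and W: "W = polytope_set A G e" "W \<noteq> {}" "compact W"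
    and X: "compact X" and f: "\<And>l. continuous_on ({0..T} \<times> X) (f l)"
    and "0 \<le> T" "0 < \<epsilon>"
  obtains v1 \<zeta> where "feasible2 T X X0 A G e f0 f p v1 (\<gamma> + \<epsilon> * T) \<zeta>"
proof -
  let ?K = "{0..T} \<times> X"
  define v1 where "v1 = (\<lambda>z. v z + \<epsilon> * (T - fst z))"
  have C1: "C1_on ?K v" using feas by (simp add: feasible1_def)
  note v1 = C1_on_add_linear_time[OF C1, where \<epsilon> = \<epsilon> and T = T, folded v1_def]
  define c where "c = (\<lambda>z. \<chi> l. f l z \<bullet> space_grad v (fst z) (snd z))"
  have c: "continuous_on ?K c"
    unfolding c_def by (intro continuous_intros f continuous_on_space_grad[OF C1])
  \<comment> \<open>Continuity of the coefficients makes their range compact, so the selection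
    applies on it.\<close>
  then have "compact (c ` ?K)" using X by (intro compact_continuous_image compact_Times) auto
  then obtain S where S: "continuous_on (c ` ?K) S" "\<And>y. y \<in> c ` ?K \<Longrightarrow> 0 \<le> S y"
      "\<And>y. y \<in> c ` ?K \<Longrightarrow> S y v* A = y" "\<And>y. y \<in> c ` ?K \<Longrightarrow> S y v* G = 0"
      "\<And>y. y \<in> c ` ?K \<Longrightarrow> \<exists>w\<in>W. e \<bullet> S y \<le> w \<bullet> y + \<epsilon>"
    using \<open>0 < \<epsilon>\<close> by (rule polytope_set_continuous_dual_selection[OF W]) (rule that)
  have "feasible2 T X X0 A G e f0 f p v1 (\<gamma> + \<epsilon> * T) (\<lambda>z. S (c z))"
    unfolding feasible2_def
  proof (intro conjI ballI allI)
    show "C1_on ?K v1" by (rule v1)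
    show "continuous_on ?K (\<lambda>z. S (c z) $ j)" for j
      by (intro continuous_intros continuous_on_compose2[OF S(1) c] subset_refl)
    show "0 \<le> S (c z) $ j" if "z \<in> ?K" for z j
      using S(2) that by (simp add: less_eq_vec_def)
    show "v1 (0, x) \<le> \<gamma> + \<epsilon> * T" if "x \<in> X0" for x
      using feas that by (simp add: feasible1_def v1_def)
    fix t x assume tx: "t \<in> {0..T}" "x \<in> X"
    then have K: "(t, x) \<in> ?K" by simp
    then have cK: "c (t, x) \<in> c ` ?K" by blast
    have "v (t, x) \<le> v1 (t, x)" using tx \<open>0 < \<epsilon>\<close> by (simp add: v1_def)
    moreover have "p x \<le> v (t, x)" using feas tx by (simp add: feasible1_def)
    ultimately show "p x \<le> v1 (t, x)" by linarith
    show "- (transpose A *v S (c (t, x))) $ l + f l (t, x) \<bullet> space_grad v1 t x = 0" for l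
      using S(3)[OF cK] v1(2)[OF K] by (simp add: c_def)
    show "transpose G *v S (c (t, x)) = 0" using S(4)[OF cK] by simp
    \<comment> \<open>The original Lie inequality is used at this single \<open>w\<close>; the
      excess \<open>\<epsilon>\<close> cancels the drop of the time derivative.\<close>
    obtain w where w: "w \<in> W" "e \<bullet> S (c (t, x)) \<le> w \<bullet> c (t, x) + \<epsilon>" using S(5)[OF cK] by blast
    have "Lie f0 f v t x w = Lie0 f0 v t x + w \<bullet> c (t, x)" by (simp add: Lie_def c_def inner_vec_def)
    moreover have "Lie f0 f v t x w \<le> 0" using feas tx w(1) by (simp add: feasible1_def)
    moreover have "Lie0 f0 v1 t x = Lie0 f0 v t x - \<epsilon>" by (simp add: Lie0_def v1(2,3)[OF K])
    ultimately show "Lie0 f0 v1 t x + e \<bullet> S (c (t, x)) \<le> 0" using w(2) by linarith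
  qed
  then show ?thesis by (rule that)
qed

theorem corollary2:
  fixes T :: real
    and X X0 :: "(real ^ 'n) set"
    and f0 :: "real \<times> (real ^ 'n) \<Rightarrow> real ^ 'n"
    and f :: "'l::finite \<Rightarrow> real \<times> (real ^ 'n) \<Rightarrow> real ^ 'n"
    and A :: "real ^ 'l ^ 'm" and G :: "real ^ 'k ^ 'm" and e :: "real ^ 'm"
    and W :: "(real ^ 'l) set"
    and p :: "real ^ 'n \<Rightarrow> real"
  assumes W_eq: "W = polytope_set A G e"
    and A1: "T > 0"
    and A2: "compact X" "compact X0" "X0 \<subseteq> X"
    and A3: "\<exists>C. C-lipschitz_on ({0..T} \<times> X) f0"
            "\<And>l. \<exists>C. C-lipschitz_on ({0..T} \<times> X) (f l)"
    and A4: "compact W" "interior W \<noteq> {}"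
    and A5: "non_return T X X0 W f0 f"
    and p_lsc: "lower_semicontinuous_on X p"
    and p_bdd: "bounded (p ` X)"
  shows "value1 T X X0 W f0 f p = value2 T X X0 A G e f0 f p"
proof (rule antisym)
  show "value1 T X X0 W f0 f p \<le> value2 T X X0 A G e f0 f p"
    \<comment> \<open>Dropping \<open>\<zeta>\<close> keeps \<open>v\<close> and
      \<open>\<gamma>\<close> feasible, so the first infimum is over a larger set of values.\<close>
    unfolding value1_def value2_def W_eq
    by (intro Inf_superset_mono) (blast dest: feasible2_imp_feasible1)
  show "value2 T X X0 A G e f0 f p \<le> value1 T X X0 W f0 f p"
    unfolding value1_def
  proof (rule Inf_greatest, clarify)
    fix v \<gamma> assume feas: "feasible1 T X X0 W f0 f p v \<gamma>"
    have f: "continuous_on ({0..T} \<times> X) (f l)" for l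
      using A3(2) lipschitz_on_continuous_on by blast
    have "W \<noteq> {}" using A4(2) interior_subset by blast
    show "value2 T X X0 A G e f0 f p \<le> ereal \<gamma>"
    proof (rule ereal_le_epsilon2)
      fix \<delta> :: real assume "0 < \<delta>"
      \<comment> \<open>Tilting with slope \<open>\<delta> / T\<close> over a horizon of length
        \<open>T\<close> raises \<open>\<gamma>\<close> by exactly \<open>\<delta>\<close>.\<close>
      then have "0 < \<delta> / T" using A1 by simp
      then obtain v1 \<zeta> where "feasible2 T X X0 A G e f0 f p v1 (\<gamma> + \<delta> / T * T) \<zeta>"
        using feasible1_imp_feasible2[OF feas W_eq \<open>W \<noteq> {}\<close> A4(1) A2(1) f] A1 by (metis less_imp_le)
      then have "feasible2 T X X0 A G e f0 f p v1 (\<gamma> + \<delta>) \<zeta>" using A1 by simp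
      then show "value2 T X X0 A G e f0 f p \<le> ereal \<gamma> + ereal \<delta>"
        unfolding value2_def by (intro Inf_lower) auto
    qed
  qed
qed

end
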